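(* Let $n>2$ and let $\mathcal{D}$ be a set of $n$ topological disks in the plane in general position with overlap number $\Delta$. Then the number of maximal faces of the arrangement $\mathcal{A}(\mathcal{D})$ is at most $n(\Delta+1)^{n(n-1)/2}$.
   Context: A topological disk is a closed region of the plane bounded by a closed Jordan curve. A set $\mathcal{D}$ of topological disks is in general position if for any two disks $D_i,D_j$ the set $\partial D_i\cap\partial D_j$ is finite, the boundaries properly cross at each intersection point (no tangencies), and no three disk boundaries share a point. The arrangement $\mathcal{A}(\mathcal{D})$ is the subdivision of the plane into faces, edges and vertices induced by the disk boundaries. For $D_i,D_j\in\mathcal{D}$, $\Delta_{ij}$ is the number of connected components of $D_i\cap D_j$, and the overlap number of $\mathcal{D}$ is $\Delta=\max_{i,j}\Delta_{ij}$. The ply of a face is the number of disks of $\mathcal{D}$ containing it. Two faces are neighbors if they share at least one edge. A face is maximal if its ply is larger than the ply of each of its neighboring faces. *)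

theory Defs
  imports "HOL-Analysis.Analysis"
begin

text \<open>The plane is modelled by the type \<^typ>\<open>complex\<close>, on which the library states the Jordan
  curve theorem.  The boundary of a topological disk is its \<^const>\<open>frontier\<close>; by that theorem it
  is the image of the bounding curve.\<close>

definition topological_disk :: "complex set \<Rightarrow> bool" where
  "topological_disk D \<longleftrightarrow>
     (\<exists>c. simple_path c \<and> pathfinish c = pathstart c \<and>
          D = path_image c \<union> inside (path_image c))"

text \<open>Two curves cross properly at a point if some neighbourhood of that point is homeomorphic to
  the open unit disk in such a way that the curves become the two coordinate diameters.\<close>

definition properly_cross_at :: "complex set \<Rightarrow> complex set \<Rightarrow> complex \<Rightarrow> bool" where
  "properly_cross_at A B p \<longleftrightarrow>
     (\<exists>U h k. open U \<and> p \<in> U \<and> homeomorphism U (ball 0 1) h k \<and> h p = 0 \<and>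
        h ` (A \<inter> U) = {z \<in> ball 0 1. Im z = 0} \<and>
        h ` (B \<inter> U) = {z \<in> ball 0 1. Re z = 0})"

definition general_position :: "complex set set \<Rightarrow> bool" where
  "general_position \<D> \<longleftrightarrow>
     (\<forall>A\<in>\<D>. \<forall>B\<in>\<D>. A \<noteq> B \<longrightarrow>
        finite (frontier A \<inter> frontier B) \<and>
        (\<forall>p \<in> frontier A \<inter> frontier B. properly_cross_at (frontier A) (frontier B) p)) \<and>
     (\<forall>A\<in>\<D>. \<forall>B\<in>\<D>. \<forall>C\<in>\<D>. A \<noteq> B \<and> A \<noteq> C \<and> B \<noteq> C \<longrightarrow>
        frontier A \<inter> frontier B \<inter> frontier C = {})"

text \<open>The maximum ranges over pairs of distinct disks, so a family of pairwise disjoint disks has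
  overlap number 0.  For disks in general position \<^term>\<open>components (A \<inter> B)\<close> is finite.\<close>

definition overlap_number :: "complex set set \<Rightarrow> nat" where
  "overlap_number \<D> = Max {card (components (A \<inter> B)) | A B. A \<in> \<D> \<and> B \<in> \<D> \<and> A \<noteq> B}"

definition arr_vertices :: "complex set set \<Rightarrow> complex set" where
  "arr_vertices \<D> = {p. \<exists>A\<in>\<D>. \<exists>B\<in>\<D>. A \<noteq> B \<and> p \<in> frontier A \<inter> frontier B}"

text \<open>Edges are taken without their end points; a boundary that meets no other boundary is a
  single edge.\<close>

definition arr_edges :: "complex set set \<Rightarrow> complex set set" where
  "arr_edges \<D> = components ((\<Union>D\<in>\<D>. frontier D) - arr_vertices \<D>)"

definition arr_faces :: "complex set set \<Rightarrow> complex set set" where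
  "arr_faces \<D> = components (- (\<Union>D\<in>\<D>. frontier D))"

definition ply :: "complex set set \<Rightarrow> complex set \<Rightarrow> nat" where
  "ply \<D> F = card {D \<in> \<D>. F \<subseteq> D}"

definition neighbors :: "complex set set \<Rightarrow> complex set \<Rightarrow> complex set \<Rightarrow> bool" where
  "neighbors \<D> F G \<longleftrightarrow>
     F \<in> arr_faces \<D> \<and> G \<in> arr_faces \<D> \<and> F \<noteq> G \<and>
     (\<exists>e \<in> arr_edges \<D>. e \<subseteq> frontier F \<and> e \<subseteq> frontier G)"

definition maximal_faces :: "complex set set \<Rightarrow> complex set set" where
  "maximal_faces \<D> = {F \<in> arr_faces \<D>. \<forall>G. neighbors \<D> F G \<longrightarrow> ply \<D> G < ply \<D> F}"

end

theory Submission
  imports Defs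
begin

text \<open>Crossing an edge out of a maximal face always leaves a disk, so a maximal face is a component
  of the common interior of the disks that contain it.  By general position the components of
  \<open>A \<inter> B\<close> correspond to those of \<open>interior A \<inter> interior B\<close>.  A Janiszewski-type argument with
  continuous logarithms shows that two points lying in a common component of every pairwise
  intersection lie in a common component of the whole intersection.  Hence a maximal face is
  determined by one disk containing it, together with the component of \<open>A \<inter> B\<close> around it (if any)
  for every pair of disks \<open>A\<close>, \<open>B\<close>; this leaves at most \<open>n (\<Delta> + 1)\<^bsup>n choose 2\<^esup>\<close> choices.\<close>

subsection \<open>Intersections of several planar open sets\<close>

text \<open>Borsuk's separation criterion: \<open>a\<close> and \<open>b\<close> lie in one
  component of the complement exactly if the direction maps from them, as maps of \<open>K\<close>
  to the circle, are homotopic. Circle maps are homotopic exactly if their quotient has a continuous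
  argument.\<close>

lemma connected_component_iff_circle_log:
  fixes a b :: complex
  assumes "compact K" "a \<notin> K" "b \<notin> K"
  shows "connected_component (- K) a b \<longleftrightarrow>
    (\<exists>g. continuous_on K g \<and>
         (\<forall>x\<in>K. exp (\<i> * of_real (g x)) = (x - a) /\<^sub>R cmod (x - a) / ((x - b) /\<^sub>R cmod (x - b))))"
    (is "_ \<longleftrightarrow> ?R")
proof -
  have c: "continuous_on K (\<lambda>x. (x - a) /\<^sub>R cmod (x - a))" "continuous_on K (\<lambda>x. (x - b) /\<^sub>R cmod (x - b))"
    using assms by (intro continuous_intros; force)+
  have s: "(\<lambda>x. (x - a) /\<^sub>R cmod (x - a)) ` K \<subseteq> sphere 0 1" "(\<lambda>x. (x - b) /\<^sub>R cmod (x - b)) ` K \<subseteq> sphere 0 1"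
    using assms by (auto simp: divide_simps)
  have "connected_component (- K) a b \<longleftrightarrow> homotopic_with_canon (\<lambda>x. True) K (sphere 0 1)
                          (\<lambda>x. (x - a) /\<^sub>R cmod (x - a))  (\<lambda>x. (x - b) /\<^sub>R cmod (x - b))"
    by (subst Borsuk_maps_homotopic_in_connected_component_eq) (use assms in auto)
  also have "\<dots> \<longleftrightarrow> ?R"
    unfolding homotopic_circlemaps_divide[where f = "\<lambda>x. (x - a) /\<^sub>R cmod (x - a)"]
      inessential_eq_continuous_logarithm_circle
    using c s[unfolded image_subset_iff_funcset] by (simp only: simp_thms eq_commute[of "exp _"])
  finally show ?thesis .
qed

text \<open>\<open>g - h\<close> is continuous with values in the integer multiples of
  \<open>2 * pi\<close>, so on a connected set it cannot leave the value 0 that it has at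
  \<open>p\<close>.\<close>

lemma circle_logs_eq:
  fixes g h :: "'a::topological_space \<Rightarrow> real"
  assumes "connected K" "continuous_on K g" "continuous_on K h"
    and eq: "\<And>x. x \<in> K \<Longrightarrow> exp (\<i> * of_real (g x)) = exp (\<i> * of_real (h x))"
    and "p \<in> K" "g p = h p" "x \<in> K"
  shows "g x = h x"
proof (rule ccontr)
  define f where "f = (\<lambda>y. \<bar>g y - h y\<bar>)"
  assume "g x \<noteq> h x"
  obtain n :: int where n: "g x - h x = 2 * of_int n * pi"
  proof -
    obtain n :: int where "\<i> * complex_of_real (g x) = \<i> * of_real (h x) + (of_int (2 * n) * pi) * \<i>"
      using eq[OF \<open>x \<in> K\<close>] by (auto simp: exp_eq)
    then have "complex_of_real (g x) = of_real (h x + 2 * of_int n * pi)"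
      by (simp add: complex_eq_iff)
    then show ?thesis using that by (metis add_diff_cancel_left' of_real_eq_iff)
  qed
  have "n \<noteq> 0" using n \<open>g x \<noteq> h x\<close> by auto
  then have "\<bar>real_of_int n\<bar> \<ge> 1" by linarith
  then have "pi \<le> 2 * \<bar>real_of_int n\<bar> * pi" using pi_gt_zero by simp
  then have "pi \<le> f x" using n by (simp add: f_def abs_mult)
  moreover have "f p = 0" using assms by (simp add: f_def)
  moreover have "connected (f ` K)"
    unfolding f_def by (intro connected_continuous_image continuous_intros assms)
  \<comment> \<open>\<open>pi\<close> lies strictly between 0 and the least positive multiple of
    \<open>2 * pi\<close>. The intermediate value theorem would make \<open>f\<close> attain it,
    where the two exponentials differ by the factor -1.\<close>
  ultimately have "pi \<in> f ` K"
    using connectedD_interval[of "f ` K" 0 "f x" pi] assms by (metis image_eqI pi_ge_zero)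
  then obtain y where y: "y \<in> K" "\<bar>g y - h y\<bar> = pi" by (auto simp: f_def)
  have "exp (\<i> * of_real (g y - h y)) = 1"
    using eq[OF y(1)] by (simp add: exp_diff right_diff_distrib)
  moreover have "g y - h y = pi \<or> g y - h y = - pi" using y(2) by linarith
  moreover have "exp (\<i> * complex_of_real (- pi)) = - 1" using exp_pi_i by (simp add: exp_minus)
  ultimately show False using exp_pi_i' by (metis one_neq_neg_one)
qed

text \<open>Every union of two of the sets carries a continuous argument of
  \<open>(z - x) / (z - y)\<close>, unique once its value at \<open>p\<close> is prescribed; these arguments
  therefore agree on each single set and paste to one on the whole union.\<close>

lemma connected_component_Compl_UN:
  fixes x y :: complex
  assumes fin: "finite I" and "I \<noteq> {}"
    and K: "\<And>i. i \<in> I \<Longrightarrow> compact (K i)" "\<And>i. i \<in> I \<Longrightarrow> connected (K i)" "\<And>i. i \<in> I \<Longrightarrow> p \<in> K i"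
    and cc: "\<And>i j. i \<in> I \<Longrightarrow> j \<in> I \<Longrightarrow> connected_component (- (K i \<union> K j)) x y"
  shows "connected_component (- (\<Union>i\<in>I. K i)) x y"
proof -
  have xy: "x \<notin> K i" "y \<notin> K i" if "i \<in> I" for i
    using connected_component_in[OF cc[OF that that]] by auto
  define \<phi> where "\<phi> = (\<lambda>z. (z - x) /\<^sub>R cmod (z - x) / ((z - y) /\<^sub>R cmod (z - y)))"
  obtain i0 where i0: "i0 \<in> I" using \<open>I \<noteq> {}\<close> by blast
  have log: "connected_component (- L) x y \<longleftrightarrow>
      (\<exists>g. continuous_on L g \<and> (\<forall>z\<in>L. exp (\<i> * of_real (g z)) = \<phi> z))"
    if "compact L" "x \<notin> L" "y \<notin> L" for L
    using connected_component_iff_circle_log[OF that] by (simp add: \<phi>_def)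
  \<comment> \<open>The case \<open>i = j\<close> of \<open>cc\<close> gives an argument on a single
    set. Its value at \<open>p\<close> becomes the common normalisation.\<close>
  obtain t where t: "exp (\<i> * of_real t) = \<phi> p"
    using cc[OF i0 i0] iffD1[OF log[of "K i0"]] xy[OF i0] K(1,3)[OF i0] by fastforce
  have "\<exists>g. continuous_on (K i \<union> K j) g \<and> (\<forall>z\<in>K i \<union> K j. exp (\<i> * of_real (g z)) = \<phi> z) \<and> g p = t"
    if ij: "i \<in> I" "j \<in> I" for i j
  proof -
    obtain g where g: "continuous_on (K i \<union> K j) g" "\<forall>z\<in>K i \<union> K j. exp (\<i> * of_real (g z)) = \<phi> z"
      using iffD1[OF log[of "K i \<union> K j"] cc] compact_Un[OF K(1) K(1), of i j] xy ij
      by blast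
    have "p \<in> K i" using K ij by blast
    \<comment> \<open>Both \<open>t\<close> and \<open>g p\<close> are arguments of
      \<open>\<phi> p\<close>, so shifting \<open>g\<close> by \<open>t - g p\<close> leaves the
      exponential unchanged.\<close>
    then have 1: "exp (\<i> * of_real (t - g p)) = 1"
      using g(2) t by (simp add: right_diff_distrib exp_diff flip: t)
    show ?thesis
    proof (intro exI conjI ballI)
      show "continuous_on (K i \<union> K j) (\<lambda>z. g z + (t - g p))"
        by (intro continuous_intros g)
      show "exp (\<i> * of_real (g z + (t - g p))) = \<phi> z" if "z \<in> K i \<union> K j" for z
        using 1 g(2) that by (simp only: of_real_add distrib_left exp_add) auto
    qed simp
  qed
  then obtain g where g: "\<And>i j. i \<in> I \<Longrightarrow> j \<in> I \<Longrightarrow> continuous_on (K i \<union> K j) (g i j)"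
    "\<And>i j z. i \<in> I \<Longrightarrow> j \<in> I \<Longrightarrow> z \<in> K i \<union> K j \<Longrightarrow> exp (\<i> * of_real (g i j z)) = \<phi> z"
    "\<And>i j. i \<in> I \<Longrightarrow> j \<in> I \<Longrightarrow> g i j p = t"
    by metis
  have same: "g i j z = g i i z" "g j i z = g i i z" if "i \<in> I" "j \<in> I" "z \<in> K i" for i j z
  proof -
    show "g i j z = g i i z"
      by (rule circle_logs_eq[OF K(2), of i _ _ p])
         (use that g K in \<open>auto intro: continuous_on_subset\<close>)
    show "g j i z = g i i z"
      by (rule circle_logs_eq[OF K(2), of i _ _ p])
         (use that g K in \<open>auto intro: continuous_on_subset\<close>)
  qed
  \<comment> \<open>Any index whose set contains \<open>z\<close> may be chosen: by
    \<open>same\<close> the value does not depend on it.\<close>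
  define G where "G = (\<lambda>z. g (SOME i. i \<in> I \<and> z \<in> K i) (SOME i. i \<in> I \<and> z \<in> K i) z)"
  have G: "G z = g i i z" if "i \<in> I" "z \<in> K i" for i z
  proof -
    define j where "j = (SOME i. i \<in> I \<and> z \<in> K i)"
    have "j \<in> I \<and> z \<in> K j" unfolding j_def by (rule someI) (use that in blast)
    then have "g j j z = g i i z" using same[of i j z] same[of j i z] that by simp
    then show ?thesis by (simp add: G_def j_def)
  qed
  have "continuous_on (K i) G" if "i \<in> I" for i
  proof -
    have "continuous_on (K i) (g i i)" using g(1)[OF that that] by simp
    then show ?thesis by (rule continuous_on_eq) (use G that in auto)
  qed
  then have "continuous_on (\<Union>i\<in>I. K i) G"
    by (intro continuous_on_closed_Union fin) (use K in \<open>auto intro: compact_imp_closed\<close>)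
  moreover have "\<forall>z\<in>\<Union>i\<in>I. K i. exp (\<i> * of_real (G z)) = \<phi> z"
    using G g(2) by auto
  moreover have "compact (\<Union>i\<in>I. K i)" using fin K by blast
  ultimately show ?thesis using log[of "\<Union>i\<in>I. K i"] xy by auto
qed

text \<open>Cut the complements down to a large closed ball. They become compact connected sets that
  all contain the bounding circle, so \<open>connected_component_Compl_UN\<close> applies with a
  point of that circle as \<open>p\<close>.\<close>

lemma connected_component_INT:
  fixes x y :: complex
  assumes fin: "finite I" and "I \<noteq> {}"
    and U: "\<And>i. i \<in> I \<Longrightarrow> open (U i)" "\<And>i. i \<in> I \<Longrightarrow> bounded (U i)" "\<And>i. i \<in> I \<Longrightarrow> connected (- U i)"
    and cc: "\<And>i j. i \<in> I \<Longrightarrow> j \<in> I \<Longrightarrow> connected_component (U i \<inter> U j) x y"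
  shows "connected_component (\<Inter>i\<in>I. U i) x y"
proof -
  have "bounded (\<Union>i\<in>I. U i)" using fin U by blast
  then obtain r where r: "r > 0" "(\<Union>i\<in>I. U i) \<subseteq> ball 0 r"
    using bounded_subset_ballD by blast
  define K where "K = (\<lambda>i. cball 0 r - U i)"
  have cK: "connected (K i)" if "i \<in> I" for i
  proof -
    \<comment> \<open>The nearest-point projection maps \<open>- U i\<close> onto
      \<open>K i\<close>: it fixes the ball and sends outer points to the sphere, which misses
      \<open>U i\<close>. Connectedness is thus inherited.\<close>
    have "closest_point (cball 0 r) z \<in> K i" if "z \<notin> U i" for z
    proof (cases "z \<in> cball 0 r")
      case True then show ?thesis using that by (simp add: K_def closest_point_self)
    next
      case False
      have "interior (cball (0::complex) r) \<noteq> {}" using r by simp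
      with False have "closest_point (cball 0 r) z \<in> frontier (cball 0 r)"
        using closest_point_in_rel_frontier[of "cball 0 r" z] r
        by (simp add: affine_hull_nonempty_interior rel_interior_nonempty_interior rel_frontier_nonempty_interior)
      then show ?thesis using r \<open>i \<in> I\<close> by (auto simp: K_def)
    qed
    moreover have "z \<in> closest_point (cball 0 r) ` (- U i)" if "z \<in> K i" for z
      using that by (intro image_eqI[of _ _ z]) (auto simp: K_def closest_point_self)
    ultimately have "closest_point (cball 0 r) ` (- U i) = K i" by blast
    moreover have "connected (closest_point (cball 0 r) ` (- U i))"
      using r by (intro connected_continuous_image U that continuous_on_closest_point) auto
    ultimately show ?thesis by simp
  qed
  have "connected_component (- (\<Union>i\<in>I. K i)) x y"
  proof (rule connected_component_Compl_UN[where p = "of_real r"])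
    show "compact (K i)" if "i \<in> I" for i
      unfolding K_def using U(1)[OF that] by (intro compact_diff) auto
    show "of_real r \<in> K i" if "i \<in> I" for i
      using r that by (auto simp: K_def)
    show "connected_component (- (K i \<union> K j)) x y" if "i \<in> I" "j \<in> I" for i j
      by (rule connected_component_of_subset[OF cc[OF that]]) (auto simp: K_def)
  qed (use assms cK in auto)
  then obtain C where C: "connected C" "C \<subseteq> - (\<Union>i\<in>I. K i)" "x \<in> C" "y \<in> C"
    by (auto simp: connected_component_def)
  have x: "x \<in> ball 0 r"
    using \<open>I \<noteq> {}\<close> cc connected_component_in r(2) by fastforce
  \<comment> \<open>The sphere is part of every \<open>K i\<close>, so \<open>C\<close>, which
    starts at \<open>x\<close> inside it, cannot escape to the exterior of the ball.\<close>
  have "C \<inter> sphere 0 r = {}" using C(2) r \<open>I \<noteq> {}\<close> unfolding K_def by fastforce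
  then have "C \<subseteq> cball 0 r"
    using connected_Int_frontier[OF C(1), of "cball 0 r"] C(3) x r(1) by force
  then have "C \<subseteq> (\<Inter>i\<in>I. U i)" using C(2) by (auto simp: K_def)
  then show ?thesis using C unfolding connected_component_def by blast
qed

subsection \<open>Local structure of topological disks\<close>

lemma topological_diskE:
  assumes "topological_disk D"
  obtains c where "simple_path c" "pathfinish c = pathstart c" "frontier D = path_image c"
    "interior D = inside (path_image c)" "- D = outside (path_image c)"
proof -
  obtain c where c: "simple_path c" "pathfinish c = pathstart c"
    and D: "D = path_image c \<union> inside (path_image c)"
    using assms unfolding topological_disk_def by blast
  note J = Jordan_inside_outside[OF c]
  have co: "- D = outside (path_image c)"
    using D J by (metis Compl_Un compl_sup outside_inside)
  have fr: "frontier D = path_image c"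
    using J co by (metis frontier_complement)
  have "interior D = D - frontier D"
    using co J by (metis Diff_Compl closed_def double_compl frontier_def closure_closed interior_subset inf.absorb2 Diff_Diff_Int)
  also have "\<dots> = inside (path_image c)"
    using D fr inside_no_overlap by blast
  finally show ?thesis using that c fr co by blast
qed

text \<open>By the Jordan curve theorem the curve is the frontier of its inside, so the interior is
  dense in the disk. The complement of the interior is connected as the closure of the
  outside.\<close>

lemma topological_disk_props:
  assumes "topological_disk D"
  shows "compact D" "connected (interior D)" "connected (- D)" "bounded (interior D)"
    "connected (- interior D)" "frontier D \<noteq> {}" "frontier D \<subseteq> closure (interior D)" "frontier D \<subseteq> closure (- D)"
    "interior D \<union> frontier D = D" "interior D \<inter> frontier D = {}"
proof -
  obtain c where c: "simple_path c" "pathfinish c = pathstart c"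
    and D: "frontier D = path_image c" "interior D = inside (path_image c)" "- D = outside (path_image c)"
    by (rule topological_diskE[OF assms])
  note J = Jordan_inside_outside[OF c]
  have "closed D" using D J by (metis closed_def)
  then have un: "interior D \<union> frontier D = D"
    using closure_Un_frontier[of D] by (metis closure_closed frontier_def interior_subset Un_Diff_cancel sup.absorb2)
  show "interior D \<union> frontier D = D" by fact
  show "interior D \<inter> frontier D = {}" by (auto simp: frontier_def)
  have cl: "closure (interior D) = D"
    using D J un closure_Un_frontier by metis
  show bd: "bounded (interior D)" and "connected (interior D)" and co: "connected (- D)"
    using D J by auto
  then show "compact D" using cl by (metis compact_closure)
  have "closure (- D) = - interior D" by (simp add: closure_complement)
  then show "connected (- interior D)" "frontier D \<subseteq> closure (- D)"
    using connected_imp_connected_closure[OF co] by (auto simp: frontier_def)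
  show "frontier D \<noteq> {}" using D by simp
  show "frontier D \<subseteq> closure (interior D)" using un cl by auto
qed

lemma connected_subset_interior:
  assumes "connected C" "C \<inter> frontier A = {}" "C \<inter> A \<noteq> {}"
  shows "C \<subseteq> interior A"
proof -
  have "C \<subseteq> A" using connected_Int_frontier[OF assms(1), of A] assms by blast
  then show ?thesis using assms(2) closure_subset[of A] by (auto simp: frontier_def)
qed

text \<open>Reparametrise the curve to start and end at \<open>p\<close>. The arc is the image of a
  middle parameter interval, and the two end pieces stay near \<open>p\<close> by
  continuity.\<close>

lemma closed_curve_arc_avoiding:
  assumes "simple_path c" "pathfinish c = pathstart c" "p \<in> path_image c" "\<epsilon> > 0"
  obtains B where "B \<subseteq> path_image c" "compact B" "connected B" "p \<notin> B" "path_image c - B \<subseteq> ball p \<epsilon>"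
proof -
  obtain a where a: "a \<in> {0..1}" "c a = p" using assms(3) by (auto simp: path_image_def)
  define c' where "c' = shiftpath a c"
  have c': "simple_path c'" "path_image c' = path_image c" "c' 0 = p" "c' 1 = p"
    using assms a simple_path_shiftpath[of c a] path_image_shiftpath[of a c] endpoints_shiftpath[of c a]
    by (auto simp: c'_def pathstart_def pathfinish_def)
  have "continuous_on {0..1} c'" using c'(1) by (simp add: simple_path_def path_def)
  then obtain d0 where d0: "d0 > 0" "\<And>t. t \<in> {0..1} \<Longrightarrow> dist t 0 < d0 \<Longrightarrow> dist (c' t) (c' 0) < \<epsilon>"
    unfolding continuous_on_iff using \<open>\<epsilon> > 0\<close> by (metis atLeastAtMost_iff order_refl zero_le_one)
  obtain d1 where d1: "d1 > 0" "\<And>t. t \<in> {0..1} \<Longrightarrow> dist t 1 < d1 \<Longrightarrow> dist (c' t) (c' 1) < \<epsilon>"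
    using \<open>continuous_on {0..1} c'\<close> unfolding continuous_on_iff using \<open>\<epsilon> > 0\<close> by (metis atLeastAtMost_iff order_refl zero_le_one)
  \<comment> \<open>Halving puts \<open>d\<close> strictly below both continuity moduli.\<close>
  define d where "d = min (1/4) (min (d0/2) (d1/2))"
  have d: "d > 0" "d \<le> 1/4" "d < d0" "d < d1" using d0(1) d1(1) by (auto simp: d_def)
  show ?thesis
  proof
    show "c' ` {d..1-d} \<subseteq> path_image c" using d c'(2) by (auto simp: path_image_def)
    have "continuous_on {d..1-d} c'"
      using d by (auto intro: continuous_on_subset[OF \<open>continuous_on {0..1} c'\<close>])
    then show "compact (c' ` {d..1-d})" "connected (c' ` {d..1-d})"
      by (auto intro: compact_continuous_image connected_continuous_image)
    have "c' t \<noteq> c' 0" if "t \<in> {d..1-d}" for t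
    proof
      assume "c' t = c' 0"
      moreover have t: "t \<in> {0..1}" "(0::real) \<in> {0..1}" using that d by auto
      ultimately have "t = 0 \<or> t = 1"
        using c'(1) t unfolding simple_path_def loop_free_def by blast
      then show False using that d by auto
    qed
    then show "p \<notin> c' ` {d..1-d}" using c'(3) by (metis imageE)
    show "path_image c - c' ` {d..1-d} \<subseteq> ball p \<epsilon>"
    proof
      fix z assume z: "z \<in> path_image c - c' ` {d..1-d}"
      then obtain t where t: "t \<in> {0..1}" "z = c' t" using c'(2) unfolding path_image_def by (metis DiffD1 imageE)
      then have "t < d \<or> t > 1 - d" using z by force
      then show "z \<in> ball p \<epsilon>"
      proof
        assume "t < d"
        then have "dist (c' t) (c' 0) < \<epsilon>" using t d by (intro d0) (auto simp: dist_real_def)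
        then show ?thesis using c' t by (simp add: dist_commute)
      next
        assume "t > 1 - d"
        then have "dist (c' t) (c' 1) < \<epsilon>" using t d by (intro d1) (auto simp: dist_real_def)
        then show ?thesis using c' t by (simp add: dist_commute)
      qed
    qed
  qed
qed

text \<open>Janiszewski's theorem for the curve and the union of a far arc of it with the complement
  of a small ball, which meet in the far arc.\<close>

lemma topological_disk_locally_connected_sides:
  assumes D: "topological_disk D" and p: "p \<in> frontier D" and "\<epsilon> > 0"
  obtains \<delta> where "\<delta> > 0" "\<delta> \<le> \<epsilon>"
    "\<And>x y. x \<in> ball p \<delta> \<Longrightarrow> y \<in> ball p \<delta> \<Longrightarrow> connected_component (- frontier D) x y \<Longrightarrow>
        connected_component (ball p \<epsilon> - frontier D) x y"
proof -
  obtain c where c: "simple_path c" "pathfinish c = pathstart c" and fr: "frontier D = path_image c"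
    using topological_diskE[OF D] by metis
  obtain B where B: "B \<subseteq> path_image c" "compact B" "connected B" "p \<notin> B"
    "path_image c - B \<subseteq> ball p \<epsilon>"
    using closed_curve_arc_avoiding[OF c _ \<open>\<epsilon> > 0\<close>, of p] p fr by metis
  have "open (- B)" using B(2) by (simp add: compact_imp_closed open_Compl)
  then obtain \<delta>0 where \<delta>0: "\<delta>0 > 0" "ball p \<delta>0 \<subseteq> - B"
    using B(4) open_contains_ball by (metis ComplI)
  show ?thesis
  proof
    show "min \<delta>0 \<epsilon> > 0" "min \<delta>0 \<epsilon> \<le> \<epsilon>" using \<delta>0 assms by auto
    fix x y assume x: "x \<in> ball p (min \<delta>0 \<epsilon>)" and y: "y \<in> ball p (min \<delta>0 \<epsilon>)"
      and cc: "connected_component (- frontier D) x y"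
    define T where "T = B \<union> - ball p \<epsilon>"
    have "connected_component (- (path_image c \<union> T)) x y"
    proof (rule Janiszewski)
      show "compact (path_image c)" using c by (simp add: compact_simple_path_image)
      show "closed T" unfolding T_def using B(2) by (intro closed_Un compact_imp_closed closed_Compl) auto
      have "path_image c \<inter> T = B" using B by (auto simp: T_def)
      then show "connected (path_image c \<inter> T)" using B by simp
      show "connected_component (- path_image c) x y" using cc fr by simp
      \<comment> \<open>The small ball misses both pieces of \<open>T\<close> and is connected, so
        it joins \<open>x\<close> and \<open>y\<close> off \<open>T\<close>.\<close>
      have "ball p (min \<delta>0 \<epsilon>) \<subseteq> - T" using \<delta>0 by (auto simp: T_def)
      then show "connected_component (- T) x y"
        unfolding connected_component_def using x y
        by (metis connected_ball)
    qed
    moreover have "- (path_image c \<union> T) \<subseteq> ball p \<epsilon> - frontier D" by (auto simp: T_def fr)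
    ultimately show "connected_component (ball p \<epsilon> - frontier D) x y"
      by (rule connected_component_of_subset)
  qed
qed

subsection \<open>Components of the intersection of two disks\<close>

text \<open>\<open>Y\<close> is dense in \<open>X\<close>, and near each point of \<open>X\<close>
  it shows only one of its components. The intended case is \<open>X = A \<inter> B\<close> and
  \<open>Y = interior A \<inter> interior B\<close>; the locale transfers components from one to the
  other.\<close>

locale locally_one_component =
  fixes X Y :: "'a::metric_space set"
  assumes clX: "closed X" and YX: "Y \<subseteq> X" and XY: "X \<subseteq> closure Y"
    and loc: "\<And>p. p \<in> X \<Longrightarrow> \<exists>N. open N \<and> p \<in> N \<and> (\<forall>x\<in>N \<inter> Y. \<forall>y\<in>N \<inter> Y. connected_component Y x y)"
begin

text \<open>All of \<open>N \<inter> Y\<close> belongs to the component of \<open>w\<close>, which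
  is that of \<open>x\<close>, and by density \<open>q\<close> is a limit of points of
  \<open>N \<inter> Y\<close>.\<close>

lemma mem_closure_component:
  assumes "open N" "\<forall>x\<in>N \<inter> Y. \<forall>y\<in>N \<inter> Y. connected_component Y x y"
    and "w \<in> N" "connected_component Y x w" "q \<in> N \<inter> X"
  shows "q \<in> closure (connected_component_set Y x)"
  unfolding closure_iff_nhds_not_empty
proof safe
  fix S M assume "M \<subseteq> S" "open M" "q \<in> M" and e: "connected_component_set Y x \<inter> S = {}"
  then have "open (M \<inter> N)" "q \<in> M \<inter> N" using assms by auto
  moreover have "q \<in> closure Y" using assms XY by auto
  ultimately obtain z where "z \<in> M" "z \<in> N" "z \<in> Y"
    by (metis IntE disjoint_iff open_Int_closure_eq_empty)
  moreover have "w \<in> Y" using assms connected_component_in by blast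
  ultimately have "connected_component Y x z"
    using assms by (meson Int_iff connected_component_trans)
  then show False using e \<open>z \<in> M\<close> \<open>M \<subseteq> S\<close> by blast
qed

text \<open>A neighbourhood as in \<open>loc\<close> around a point of this closure meets the
  component, so the closure swallows its whole trace on \<open>X\<close>.\<close>

lemma openin_closure_component: "openin (top_of_set X) (closure (connected_component_set Y x))"
proof (subst openin_subopen, safe)
  fix p assume p: "p \<in> closure (connected_component_set Y x)"
  moreover have "closure (connected_component_set Y x) \<subseteq> X"
    using clX YX connected_component_subset by (metis closure_minimal order_trans)
  ultimately have "p \<in> X" by blast
  from loc[OF this] obtain N where N: "open N" "p \<in> N" "\<forall>x\<in>N \<inter> Y. \<forall>y\<in>N \<inter> Y. connected_component Y x y"
    by blast
  then obtain w where "w \<in> N" "connected_component Y x w"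
    using p by (metis disjoint_iff mem_Collect_eq open_Int_closure_eq_empty)
  then have "X \<inter> N \<subseteq> closure (connected_component_set Y x)"
    using mem_closure_component[OF N(1,3)] by blast
  then show "\<exists>T. openin (top_of_set X) T \<and> p \<in> T \<and> T \<subseteq> closure (connected_component_set Y x)"
    using N \<open>p \<in> X\<close> by (intro exI[of _ "X \<inter> N"]) auto
qed

text \<open>The closure of the \<open>Y\<close>-component of \<open>x\<close> is clopen in
  \<open>X\<close>, so a connected set in \<open>X\<close> through \<open>x\<close> stays in it and
  \<open>y\<close> is a limit of that component. Then \<open>loc\<close> at \<open>y\<close> puts
  \<open>y\<close> into the component itself.\<close>

lemma connected_component_dense:
  assumes "connected_component X x y" "x \<in> Y" "y \<in> Y"
  shows "connected_component Y x y"
proof -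
  let ?W = "closure (connected_component_set Y x)"
  obtain C where C: "connected C" "C \<subseteq> X" "x \<in> C" "y \<in> C"
    using assms(1) by (auto simp: connected_component_def)
  obtain T where "open T" "?W = X \<inter> T"
    using openin_closure_component by (metis openin_open)
  then have "C \<inter> ?W = C \<inter> T" using C(2) by blast
  then have "openin (top_of_set C) (C \<inter> ?W)"
    using \<open>open T\<close> by (metis openin_open_Int)
  moreover have "closedin (top_of_set C) (C \<inter> ?W)" by (simp add: closedin_closed_Int)
  moreover have "x \<in> C \<inter> ?W" using C assms closure_subset[of "connected_component_set Y x"] by auto
  ultimately have "C \<inter> ?W = C" using C(1) unfolding connected_clopen by blast
  then have y: "y \<in> ?W" using C by blast
  from loc[of y] obtain N where N: "open N" "y \<in> N" "\<forall>x\<in>N \<inter> Y. \<forall>y\<in>N \<inter> Y. connected_component Y x y"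
    using assms YX by blast
  then obtain w where "w \<in> N" "connected_component Y x w"
    using y by (metis disjoint_iff mem_Collect_eq open_Int_closure_eq_empty)
  then show ?thesis using N assms by (meson Int_iff connected_component_in connected_component_trans)
qed

text \<open>The components of \<open>X\<close> are relatively open, so compactness extracts a finite
  subcover; being disjoint and nonempty, all of them must occur in it.\<close>

lemma finite_components:
  assumes "compact X"
  shows "finite (components X)"
proof -
  have "openin (top_of_set X) C" if C: "C \<in> components X" for C
  proof (subst openin_subopen, safe)
    fix p assume p: "p \<in> C"
    then have pX: "p \<in> X" using C in_components_subset by blast
    from loc[OF this] obtain N where N: "open N" "p \<in> N" "\<forall>x\<in>N \<inter> Y. \<forall>y\<in>N \<inter> Y. connected_component Y x y"
      by blast
    have "p \<in> closure Y" using pX XY by blast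
    then obtain x where x: "x \<in> N" "x \<in> Y"
      using N by (metis disjoint_iff open_Int_closure_eq_empty)
    let ?W = "closure (connected_component_set Y x)"
    have "p \<in> ?W" by (rule mem_closure_component[OF N(1,3)]) (use x N pX in auto)
    moreover have "connected ?W" by (simp add: connected_imp_connected_closure)
    moreover have "?W \<subseteq> X"
      using clX YX connected_component_subset by (metis closure_minimal order_trans)
    ultimately have "?W \<subseteq> C" using components_maximal[OF C] p by blast
    then show "\<exists>T. openin (top_of_set X) T \<and> p \<in> T \<and> T \<subseteq> C"
      using openin_closure_component \<open>p \<in> ?W\<close> by blast
  qed
  then obtain F where F: "F \<subseteq> components X" "finite F" "X \<subseteq> \<Union>F"
    using assms unfolding compact_eq_openin_cover by (metis Union_components order_refl)
  have "components X \<subseteq> F"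
  proof
    fix C assume C: "C \<in> components X"
    then obtain p where "p \<in> C" "p \<in> X" using in_components_nonempty in_components_subset by blast
    then obtain C' where "C' \<in> F" "p \<in> C'" using F by blast
    then show "C \<in> F" using C F \<open>p \<in> C\<close> components_nonoverlap by blast
  qed
  then show ?thesis using F finite_subset by blast
qed

end

text \<open>Neither side of the curve can miss \<^term>\<open>U\<close>, since every boundary point of the disk is a
  limit of both sides.\<close>

lemma topological_disk_half_ball_chart:
  fixes p u :: complex
  assumes D: "topological_disk D" and U: "open U" "p \<in> U" "homeomorphism U (ball 0 1) h k"
    and p: "p \<in> frontier D"
    and fr: "h ` (frontier D \<inter> U) = {z \<in> ball 0 1. u \<bullet> z = 0}"
  obtains s where "s = u \<or> s = - u" "h ` (interior D \<inter> U) = {z \<in> ball 0 1. s \<bullet> z > 0}"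
proof -
  define H where "H = (\<lambda>s::complex. {z \<in> ball 0 1. s \<bullet> z > 0})"
  note tp = topological_disk_props[OF D]
  have hk: "\<And>x. x \<in> U \<Longrightarrow> k (h x) = x" "\<And>y. y \<in> ball 0 1 \<Longrightarrow> h (k y) = y" "h ` U = ball 0 1" "k ` ball 0 1 = U"
    "continuous_on (ball 0 1) k"
    using U(3) by (auto simp: homeomorphism_def)
  have H: "connected (k ` H s)" "k ` H s \<inter> frontier D = {}" if "s = u \<or> s = - u" for s
  proof -
    have "H s = ball 0 1 \<inter> {z. s \<bullet> z > 0}" by (auto simp: H_def)
    then have "convex (H s)" by (simp add: convex_Int convex_halfspace_gt)
    then show "connected (k ` H s)"
      by (intro connected_continuous_image convex_connected continuous_on_subset[OF hk(5)]) (auto simp: H_def)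
    show "k ` H s \<inter> frontier D = {}"
    proof safe
      fix z assume z: "z \<in> H s" "k z \<in> frontier D"
      then have "k z \<in> U" "h (k z) = z" using hk by (auto simp: H_def)
      then have "z \<in> h ` (frontier D \<inter> U)" using z by (metis IntI image_eqI)
      then have "u \<bullet> z = 0" using fr by auto
      then show "k z \<in> {}" using z that by (auto simp: H_def)
    qed
  qed
  have sub: "k ` H s \<subseteq> interior D" if "s = u \<or> s = - u" "k ` H s \<inter> D \<noteq> {}" for s
    by (rule connected_subset_interior) (use H[OF that(1)] that(2) in auto)
  have cov: "x \<in> k ` H u \<union> k ` H (- u)" if "x \<in> U" "x \<notin> frontier D" for x
  proof -
    have hx: "h x \<in> ball 0 1" using that hk by blast
    have "u \<bullet> h x \<noteq> 0"
    proof
      assume "u \<bullet> h x = 0"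
      then have "h x \<in> h ` (frontier D \<inter> U)" using fr hx by auto
      then show False using that hk by (metis IntE imageE)
    qed
    then have "h x \<in> H u \<or> h x \<in> H (- u)" using hx by (auto simp: H_def)
    then show ?thesis using hk that by (metis UnCI image_eqI)
  qed
  \<comment> \<open>The points \<open>a\<close> inside and \<open>b\<close> outside the disk decide
    which half of the chart is the interior side: neither half can contain both.\<close>
  obtain a where a: "a \<in> U" "a \<in> interior D"
    using tp(7) p U by (metis disjoint_iff open_Int_closure_eq_empty subsetD)
  obtain b where b: "b \<in> U" "b \<notin> D"
    using tp(8) p U by (metis ComplD disjoint_iff open_Int_closure_eq_empty subsetD)
  have "a \<notin> frontier D" "b \<notin> frontier D" using tp(9,10) a b by auto
  obtain s where s: "s = u \<or> s = - u" "a \<in> k ` H s"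
    using cov[of a] a \<open>a \<notin> frontier D\<close> by blast
  have 1: "k ` H s \<subseteq> interior D" using sub s a interior_subset by blast
  have "b \<in> k ` H (- s)" using cov[of b] b 1 s(1) \<open>b \<notin> frontier D\<close> interior_subset by auto
  then have 2: "k ` H (- s) \<inter> D = {}"
    using sub[of "- s"] s(1) b interior_subset by (metis add.inverse_inverse disjoint_iff subsetD)
  have "interior D \<inter> U = k ` H s"
  proof
    show "k ` H s \<subseteq> interior D \<inter> U" using 1 hk(4) by (auto simp: H_def)
    show "interior D \<inter> U \<subseteq> k ` H s"
      using cov 2 s(1) tp(10) interior_subset[of D] by fastforce
  qed
  then have "h ` (interior D \<inter> U) = H s" using hk(2) by (force simp: H_def)
  then show ?thesis using that s(1) by (simp add: H_def)
qed

text \<open>In the crossing chart the two interiors become half disks on perpendicular diameters.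
  Their intersection is an open quarter disk: convex, hence connected, with the centre in its
  closure.\<close>

lemma properly_crossing_disks_local:
  assumes A: "topological_disk A" and B: "topological_disk B"
    and cr: "properly_cross_at (frontier A) (frontier B) p"
    and p: "p \<in> frontier A" "p \<in> frontier B"
  obtains U where "open U" "p \<in> U" "connected (U \<inter> (interior A \<inter> interior B))"
    "p \<in> closure (interior A \<inter> interior B)"
proof -
  obtain U h k where U: "open U" "p \<in> U" "homeomorphism U (ball 0 1) h k" and hp: "h p = 0"
    and hA: "h ` (frontier A \<inter> U) = {z \<in> ball 0 1. Im z = 0}"
    and hB: "h ` (frontier B \<inter> U) = {z \<in> ball 0 1. Re z = 0}"
    using cr unfolding properly_cross_at_def by blast
  obtain s where s: "s = \<i> \<or> s = - \<i>" "h ` (interior A \<inter> U) = {z \<in> ball 0 1. s \<bullet> z > 0}"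
    by (rule topological_disk_half_ball_chart[OF A U p(1), of \<i>]) (use hA in \<open>simp_all add: inner_complex_def\<close>)
  obtain t where t: "t = 1 \<or> t = - 1" "h ` (interior B \<inter> U) = {z \<in> ball 0 1. t \<bullet> z > 0}"
    by (rule topological_disk_half_ball_chart[OF B U p(2), of 1]) (use hB in \<open>simp_all add: inner_complex_def\<close>)
  have hk: "\<And>x. x \<in> U \<Longrightarrow> k (h x) = x" "\<And>y. y \<in> ball 0 1 \<Longrightarrow> h (k y) = y" "h ` U = ball 0 1" "k ` ball 0 1 = U"
    "continuous_on (ball 0 1) k"
    using U(3) by (auto simp: homeomorphism_def)
  define Q where "Q = {z \<in> ball 0 1. s \<bullet> z > 0 \<and> t \<bullet> z > 0}"
  have memQ: "x \<in> interior A \<inter> interior B" if "x \<in> k ` Q" for x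
  proof -
    from that obtain z where z: "z \<in> Q" "x = k z" by blast
    then have "z \<in> h ` (interior A \<inter> U)" "z \<in> h ` (interior B \<inter> U)" using s t by (auto simp: Q_def)
    then show ?thesis using hk z by auto
  qed
  have QU: "U \<inter> (interior A \<inter> interior B) = k ` Q"
  proof
    show "k ` Q \<subseteq> U \<inter> (interior A \<inter> interior B)" using memQ hk(4) by (auto simp: Q_def)
    show "U \<inter> (interior A \<inter> interior B) \<subseteq> k ` Q"
    proof
      fix x assume x: "x \<in> U \<inter> (interior A \<inter> interior B)"
      then have "h x \<in> h ` (interior A \<inter> U)" "h x \<in> h ` (interior B \<inter> U)" by auto
      then have "h x \<in> Q" using s t by (auto simp: Q_def)
      then show "x \<in> k ` Q" using hk x by (metis IntD1 image_eqI)
    qed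
  qed
  have "Q = ball 0 1 \<inter> {z. s \<bullet> z > 0} \<inter> {z. t \<bullet> z > 0}" by (auto simp: Q_def)
  then have "convex Q" by (simp add: convex_Int convex_halfspace_gt)
  then have "connected (k ` Q)"
    by (intro connected_continuous_image convex_connected continuous_on_subset[OF hk(5)]) (auto simp: Q_def)
  moreover have "p \<in> closure (interior A \<inter> interior B)"
    unfolding closure_iff_nhds_not_empty
  proof safe
    fix S M assume M: "M \<subseteq> S" "open M" "p \<in> M" and e: "(interior A \<inter> interior B) \<inter> S = {}"
    have "open (k -` M \<inter> ball 0 1)"
      using continuous_on_open_vimage[of "ball 0 1" k] hk(5) M(2) by auto
    moreover have "k 0 = p" using hk(1) U(2) hp by metis
    ultimately obtain r where r: "r > 0" "ball 0 r \<subseteq> k -` M \<inter> ball 0 1"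
      using M(3) open_contains_ball[of "k -` M \<inter> ball 0 1"]
      by (metis Int_iff centre_in_ball vimageI zero_less_one)
    \<comment> \<open>A point on the bisector of the quadrant: \<open>s\<close> and \<open>t\<close>
      are orthonormal, so both inner products with \<open>s + t\<close> are 1, and the factor
      \<open>r/4\<close> keeps the norm within \<open>r/2\<close>.\<close>
    define z where "z = (r/4) *\<^sub>R (s + t)"
    have "norm (s + t) \<le> 2" using s t norm_triangle_ineq[of s t] by auto
    then have "norm z \<le> (r/4) * 2" using r by (simp add: z_def)
    then have z: "z \<in> ball 0 r" using r(1) by (simp only: mem_ball_0)
    moreover have "s \<bullet> (s + t) = 1" "t \<bullet> (s + t) = 1" using s(1) t(1) by (auto simp: inner_complex_def)
    moreover have "z \<in> ball 0 1" using z r by blast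
    ultimately have "z \<in> Q" using r(1) by (simp add: Q_def z_def)
    then have "k z \<in> interior A \<inter> interior B" using memQ by blast
    moreover have "k z \<in> M" using z r by auto
    ultimately show False using e M by blast
  qed
  ultimately show ?thesis using that U QU by metis
qed

text \<open>Three kinds of points occur. In both interiors a small ball serves; on one boundary
  only, \<open>topological_disk_locally_connected_sides\<close> inside a ball in the other interior;
  on both, the crossing chart.\<close>

lemma locally_one_component_Int_disks:
  assumes A: "topological_disk A" and B: "topological_disk B"
    and cr: "\<And>p. p \<in> frontier A \<inter> frontier B \<Longrightarrow> properly_cross_at (frontier A) (frontier B) p"
  shows "locally_one_component (A \<inter> B) (interior A \<inter> interior B)"
proof -
  let ?Y = "interior A \<inter> interior B"
  \<comment> \<open>Stated for arbitrary disks in either role, so that it serves both cases with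
    exactly one boundary through \<open>p\<close>.\<close>
  have one_side: "(\<exists>N. open N \<and> p \<in> N \<and> (\<forall>x\<in>N \<inter> (interior A \<inter> interior B). \<forall>y\<in>N \<inter> (interior A \<inter> interior B).
      connected_component (interior A \<inter> interior B) x y)) \<and> p \<in> closure (interior A \<inter> interior B)"
    if A: "topological_disk A" and p: "p \<in> frontier A" "p \<in> interior B" for A B p
  proof -
    obtain \<epsilon> where \<epsilon>: "\<epsilon> > 0" "ball p \<epsilon> \<subseteq> interior B"
      using p open_contains_ball by (metis open_interior)
    obtain \<delta> where \<delta>: "\<delta> > 0" and ulc: "\<And>x y. x \<in> ball p \<delta> \<Longrightarrow> y \<in> ball p \<delta> \<Longrightarrow>
        connected_component (- frontier A) x y \<Longrightarrow> connected_component (ball p \<epsilon> - frontier A) x y"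
      using topological_disk_locally_connected_sides[OF A p(1) \<epsilon>(1)] by metis
    note tp = topological_disk_props[OF A]
    have "connected_component (interior A \<inter> interior B) x y"
      if xy: "x \<in> ball p \<delta> \<inter> (interior A \<inter> interior B)" "y \<in> ball p \<delta> \<inter> (interior A \<inter> interior B)" for x y
    proof -
      have "connected_component (- frontier A) x y"
        unfolding connected_component_def using xy tp(2,10) by (intro exI[of _ "interior A"]) auto
      then have "connected_component (ball p \<epsilon> - frontier A) x y" using ulc xy by blast
      then obtain C where C: "connected C" "C \<subseteq> ball p \<epsilon> - frontier A" "x \<in> C" "y \<in> C"
        by (auto simp: connected_component_def)
      have "C \<subseteq> interior A"
        by (rule connected_subset_interior) (use C xy interior_subset in auto)
      then have "C \<subseteq> interior A \<inter> interior B" using C \<epsilon> by blast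
      then show ?thesis using C unfolding connected_component_def by blast
    qed
    moreover have "p \<in> closure (interior A \<inter> interior B)"
      using tp(7) p open_Int_closure_subset[OF open_interior[of B], of "interior A"] by (auto simp: Int_commute)
    ultimately show ?thesis using \<delta> by (meson centre_in_ball open_ball)
  qed
  have both: "(\<exists>N. open N \<and> p \<in> N \<and> (\<forall>x\<in>N \<inter> ?Y. \<forall>y\<in>N \<inter> ?Y. connected_component ?Y x y)) \<and> p \<in> closure ?Y"
    if "p \<in> A \<inter> B" for p
  proof -
    have "p \<in> interior A \<or> p \<in> frontier A" "p \<in> interior B \<or> p \<in> frontier B"
      using that topological_disk_props(9)[OF A] topological_disk_props(9)[OF B] by auto
    then consider "p \<in> ?Y" | "p \<in> frontier A" "p \<in> interior B" | "p \<in> interior A" "p \<in> frontier B"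
      | "p \<in> frontier A" "p \<in> frontier B" by blast
    then show ?thesis
    proof cases
      case 1
      then obtain \<epsilon> where \<epsilon>: "\<epsilon> > 0" "ball p \<epsilon> \<subseteq> ?Y"
        using open_contains_ball by (metis open_Int open_interior)
      then have "connected_component ?Y x y" if "x \<in> ball p \<epsilon>" "y \<in> ball p \<epsilon>" for x y
        using that unfolding connected_component_def by (metis connected_ball)
      then have "\<exists>N. open N \<and> p \<in> N \<and> (\<forall>x\<in>N \<inter> ?Y. \<forall>y\<in>N \<inter> ?Y. connected_component ?Y x y)"
        using \<epsilon> by (intro exI[of _ "ball p \<epsilon>"]) auto
      then show ?thesis using 1 closure_subset by blast
    next
      case 2 then show ?thesis using one_side[OF A] by blast
    next
      case 3 then show ?thesis using one_side[OF B, of p A] by (simp add: Int_commute)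
    next
      case 4
      then obtain U where U: "open U" "p \<in> U" "connected (U \<inter> ?Y)" "p \<in> closure ?Y"
        using properly_crossing_disks_local[OF A B cr] by blast
      then have "connected_component ?Y x y" if "x \<in> U \<inter> ?Y" "y \<in> U \<inter> ?Y" for x y
        using that unfolding connected_component_def by (metis inf_le2)
      then show ?thesis using U by blast
    qed
  qed
  show ?thesis
  proof
    show "closed (A \<inter> B)"
      using topological_disk_props(1) A B by (simp add: closed_Int compact_imp_closed)
    show "?Y \<subseteq> A \<inter> B" using interior_subset by blast
    show "A \<inter> B \<subseteq> closure ?Y" using both by blast
    show "\<exists>N. open N \<and> p \<in> N \<and> (\<forall>x\<in>N \<inter> ?Y. \<forall>y\<in>N \<inter> ?Y. connected_component ?Y x y)"
      if "p \<in> A \<inter> B" for p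
      using both[OF that] by blast
  qed
qed

subsection \<open>Maximal faces of an arrangement\<close>

locale disk_arrangement =
  fixes \<D> :: "complex set set"
  assumes fin: "finite \<D>" and disk: "\<And>D. D \<in> \<D> \<Longrightarrow> topological_disk D"
    and gp: "general_position \<D>"
begin

abbreviation "boundaries \<equiv> \<Union>D\<in>\<D>. frontier D"

lemma closed_boundaries: "closed boundaries"
  using fin by auto

lemma finite_arr_vertices: "finite (arr_vertices \<D>)"
proof -
  have "arr_vertices \<D> = (\<Union>A\<in>\<D>. \<Union>B\<in>\<D> - {A}. frontier A \<inter> frontier B)"
    by (auto simp: arr_vertices_def)
  moreover have "finite (frontier A \<inter> frontier B)" if "A \<in> \<D>" "B \<in> \<D> - {A}" for A B
    using gp that unfolding general_position_def by auto
  ultimately show ?thesis using fin by (metis (no_types, lifting) finite_Diff finite_UN_I)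
qed

lemma face_props:
  assumes "F \<in> arr_faces \<D>"
  shows "open F" "connected F" "F \<noteq> {}" "F \<inter> boundaries = {}" "frontier F \<subseteq> boundaries"
proof -
  have F: "F \<in> components (- boundaries)" using assms by (simp add: arr_faces_def)
  show "open F" using open_components[OF open_Compl[OF closed_boundaries] F] .
  show "connected F" "F \<noteq> {}" using F in_components_connected in_components_nonempty by auto
  show "F \<inter> boundaries = {}" using in_components_subset[OF F] by auto
  have "frontier F \<subseteq> frontier (- boundaries)" using frontier_of_components_subset F by blast
  then show "frontier F \<subseteq> boundaries"
    using closed_boundaries by (metis closure_closed frontier_complement frontier_subset_eq order_trans)
qed

lemma face_component:
  assumes "F \<in> arr_faces \<D>" "x \<in> F" "connected_component (- boundaries) x y"
  shows "y \<in> F"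
proof -
  obtain z where "F = connected_component_set (- boundaries) z"
    using assms(1) unfolding arr_faces_def components_def by blast
  then show ?thesis using assms(2,3) connected_component_trans by fastforce
qed

lemma face_subset_disk:
  assumes "F \<in> arr_faces \<D>" "D \<in> \<D>" "x \<in> F" "x \<in> D"
  shows "F \<subseteq> interior D"
  by (rule connected_subset_interior) (use assms face_props[OF assms(1)] in auto)

text \<open>The other boundaries form a closed set missing \<open>p\<close>, so near
  \<open>p\<close> the arrangement looks like the single curve \<open>frontier D\<close>, and each
  side of it near \<open>p\<close> belongs to one face.\<close>

lemma boundary_point_two_sides:
  assumes D: "D \<in> \<D>" and p: "p \<in> frontier D" "p \<notin> arr_vertices \<D>"
  obtains N where "open N" "p \<in> N"
    "\<And>D'. D' \<in> \<D> \<Longrightarrow> D' \<noteq> D \<Longrightarrow> N \<inter> frontier D' = {}"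
    "\<And>D'. D' \<in> \<D> \<Longrightarrow> D' \<noteq> D \<Longrightarrow> N \<subseteq> D' \<or> N \<inter> D' = {}"
    "\<And>S x y. S = interior D \<or> S = - D \<Longrightarrow> x \<in> N \<inter> S \<Longrightarrow> y \<in> N \<inter> S \<Longrightarrow> connected_component (- boundaries) x y"
proof -
  note tp = topological_disk_props[OF disk[OF D]]
  have "open (- (\<Union>D'\<in>\<D> - {D}. frontier D'))" using fin by auto
  moreover have "p \<notin> (\<Union>D'\<in>\<D> - {D}. frontier D')" using p D by (auto simp: arr_vertices_def)
  ultimately obtain \<epsilon> where \<epsilon>: "\<epsilon> > 0" "ball p \<epsilon> \<subseteq> - (\<Union>D'\<in>\<D> - {D}. frontier D')"
    using open_contains_ball by (metis ComplI)
  obtain \<delta> where \<delta>: "\<delta> > 0" "\<delta> \<le> \<epsilon>" and ulc: "\<And>x y. x \<in> ball p \<delta> \<Longrightarrow> y \<in> ball p \<delta> \<Longrightarrow>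
      connected_component (- frontier D) x y \<Longrightarrow> connected_component (ball p \<epsilon> - frontier D) x y"
    using topological_disk_locally_connected_sides[OF disk[OF D] p(1) \<epsilon>(1)] by metis
  have sub: "ball p \<delta> \<subseteq> ball p \<epsilon>" using \<delta> by auto
  show ?thesis
  proof
    show "open (ball p \<delta>)" "p \<in> ball p \<delta>" using \<delta> by auto
    show av: "ball p \<delta> \<inter> frontier D' = {}" if "D' \<in> \<D>" "D' \<noteq> D" for D'
      using \<epsilon> sub that by blast
    show "ball p \<delta> \<subseteq> D' \<or> ball p \<delta> \<inter> D' = {}" if "D' \<in> \<D>" "D' \<noteq> D" for D'
      using connected_Int_frontier[OF connected_ball, of p \<delta> D'] av[OF that] by blast
    fix S x y assume S: "S = interior D \<or> S = - D" and xy: "x \<in> ball p \<delta> \<inter> S" "y \<in> ball p \<delta> \<inter> S"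
    have "connected S" "S \<subseteq> - frontier D" using S tp(2,3,9,10) by auto
    then have "connected_component (- frontier D) x y"
      using xy unfolding connected_component_def by blast
    then have "connected_component (ball p \<epsilon> - frontier D) x y" using ulc xy by blast
    then show "connected_component (- boundaries) x y"
      by (rule connected_component_of_subset) (use \<epsilon> in auto)
  qed
qed

text \<open>Away from the vertices \<open>frontier D\<close> and the union of the other boundaries
  are disjoint closed sets, and a connected edge lies in just one of them.\<close>

lemma edge_subset_frontier_disk:
  assumes e: "e \<in> arr_edges \<D>" and p: "p \<in> e" "p \<in> frontier D" and D: "D \<in> \<D>"
  shows "e \<subseteq> frontier D"
proof -
  have e': "connected e" "e \<subseteq> boundaries - arr_vertices \<D>"
    using e in_components_connected in_components_subset unfolding arr_edges_def by blast+
  define R where "R = (\<Union>D'\<in>\<D> - {D}. frontier D')"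
  have "closed R" using fin by (auto simp: R_def)
  moreover have "e \<subseteq> frontier D \<union> R" using e'(2) by (auto simp: R_def)
  moreover have "frontier D \<inter> R \<inter> e = {}"
    using e'(2) D by (auto simp: R_def arr_vertices_def)
  ultimately have "R \<inter> e = {}"
    using e'(1) p unfolding connected_closed by (metis (no_types, lifting) IntI empty_iff frontier_closed)
  then show ?thesis using \<open>e \<subseteq> frontier D \<union> R\<close> by blast
qed

text \<open>\<open>e \<inter> frontier F\<close> is clopen in \<open>e\<close>. It is open because
  near each of its points \<open>F\<close> fills a whole side of the curve, and every nearby point
  of the curve is a limit of that side.\<close>

lemma edge_subset_frontier_face:
  assumes F: "F \<in> arr_faces \<D>" and e: "e \<in> arr_edges \<D>" and p: "p \<in> e" "p \<in> frontier F"
  shows "e \<subseteq> frontier F"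
proof -
  have e': "connected e" "e \<subseteq> boundaries - arr_vertices \<D>"
    using e in_components_connected in_components_subset unfolding arr_edges_def by blast+
  then obtain D where D: "D \<in> \<D>" "p \<in> frontier D" using p by blast
  have eD: "e \<subseteq> frontier D" using edge_subset_frontier_disk[OF e p(1) D(2,1)] .
  note tp = topological_disk_props[OF disk[OF D(1)]]
  note fp = face_props[OF F]
  have "openin (top_of_set e) (e \<inter> frontier F)"
  proof (subst openin_subopen, safe)
    fix q assume q: "q \<in> e" "q \<in> frontier F"
    have q': "q \<in> frontier D" "q \<notin> arr_vertices \<D>" using q eD e' by auto
    obtain N where N: "open N" "q \<in> N" and
      side: "\<And>S x y. S = interior D \<or> S = - D \<Longrightarrow> x \<in> N \<inter> S \<Longrightarrow> y \<in> N \<inter> S \<Longrightarrow> connected_component (- boundaries) x y"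
      using boundary_point_two_sides[OF D(1) q'] by metis
    have "q \<in> closure F" using q by (simp add: frontier_def)
    then obtain x where x: "x \<in> F" "x \<in> N"
      using N by (metis disjoint_iff open_Int_closure_eq_empty)
    have "x \<notin> frontier D" using x(1) fp(4) D(1) by auto
    then obtain S where S: "S = interior D \<or> S = - D" "x \<in> S" using tp(9) by blast
    have "N \<inter> S \<subseteq> F" using face_component[OF F x(1)] side[OF S(1)] x S by blast
    have "e \<inter> N \<subseteq> frontier F"
    proof
      fix z assume z: "z \<in> e \<inter> N"
      then have "z \<in> closure S" using eD S(1) tp(7,8) by auto
      then have "z \<in> closure (N \<inter> S)" using open_Int_closure_subset[OF N(1), of S] z by auto
      then have "z \<in> closure F" using \<open>N \<inter> S \<subseteq> F\<close> closure_mono by blast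
      moreover have "z \<notin> F" using fp(4) e'(2) z by auto
      ultimately show "z \<in> frontier F" using fp(1) by (simp add: frontier_def interior_open)
    qed
    then show "\<exists>T. openin (top_of_set e) T \<and> q \<in> T \<and> T \<subseteq> e \<inter> frontier F"
      using N q by (intro exI[of _ "e \<inter> N"]) auto
  qed
  moreover have "closedin (top_of_set e) (e \<inter> frontier F)" by (simp add: closedin_closed_Int)
  ultimately have "e \<inter> frontier F = {} \<or> e \<inter> frontier F = e"
    using e'(1) unfolding connected_clopen by blast
  then show ?thesis using p by blast
qed

text \<open>Otherwise the face across the edge through \<^term>\<open>p\<close> would have ply one larger.\<close>

lemma maximal_face_boundary_point:
  assumes F: "F \<in> maximal_faces \<D>" and p: "p \<in> frontier F" "p \<notin> arr_vertices \<D>"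
    and D: "D \<in> \<D>" "p \<in> frontier D"
  shows "F \<subseteq> D"
proof (rule ccontr)
  assume nF: "\<not> F \<subseteq> D"
  have Ff: "F \<in> arr_faces \<D>" using F by (simp add: maximal_faces_def)
  note tp = topological_disk_props[OF disk[OF D(1)]]
  define e where "e = connected_component_set (boundaries - arr_vertices \<D>) p"
  have pe: "p \<in> boundaries - arr_vertices \<D>" using p D by auto
  then have e: "e \<in> arr_edges \<D>" "p \<in> e"
    unfolding e_def arr_edges_def by (auto intro: componentsI)
  obtain N where N: "open N" "p \<in> N"
    and av: "\<And>D'. D' \<in> \<D> \<Longrightarrow> D' \<noteq> D \<Longrightarrow> N \<inter> frontier D' = {}"
    and dich: "\<And>D'. D' \<in> \<D> \<Longrightarrow> D' \<noteq> D \<Longrightarrow> N \<subseteq> D' \<or> N \<inter> D' = {}"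
    and side: "\<And>S x y. S = interior D \<or> S = - D \<Longrightarrow> x \<in> N \<inter> S \<Longrightarrow> y \<in> N \<inter> S \<Longrightarrow> connected_component (- boundaries) x y"
    using boundary_point_two_sides[OF D p(2)] by metis
  have "p \<in> closure F" using p by (simp add: frontier_def)
  then obtain x where x: "x \<in> F" "x \<in> N"
    using N by (metis disjoint_iff open_Int_closure_eq_empty)
  have "p \<in> closure (interior D)" using tp(7) D by blast
  then obtain y where y: "y \<in> interior D" "y \<in> N"
    using N by (metis disjoint_iff open_Int_closure_eq_empty)
  \<comment> \<open>\<open>G\<close> is the face on the inner side of \<open>frontier D\<close> at
    \<open>p\<close>, while \<open>F\<close> lies on the outer side.\<close>
  define G where "G = connected_component_set (- boundaries) y"
  have "y \<notin> boundaries" using av y tp(10) D(1) by blast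
  then have G: "G \<in> arr_faces \<D>" "y \<in> G"
    unfolding G_def arr_faces_def by (auto intro: componentsI)
  have "N \<inter> interior D \<subseteq> G" using face_component[OF G] side[of "interior D"] y by blast
  moreover have "p \<in> closure (N \<inter> interior D)"
    using open_Int_closure_subset[OF N(1), of "interior D"] N(2) \<open>p \<in> closure (interior D)\<close> by auto
  ultimately have "p \<in> closure G" using closure_mono by blast
  moreover have "p \<notin> G" using face_props(4)[OF G(1)] pe by auto
  ultimately have pG: "p \<in> frontier G"
    using face_props(1)[OF G(1)] by (simp add: frontier_def interior_open)
  have "y \<in> D" using y interior_subset by blast
  then have GD: "G \<subseteq> D" using face_subset_disk[OF G(1) D(1) G(2)] interior_subset by blast
  then have "neighbors \<D> F G"
    unfolding neighbors_def
    using Ff G(1) nF e edge_subset_frontier_face[OF Ff e p(1)] edge_subset_frontier_face[OF G(1) e pG] by blast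
  then have lt: "ply \<D> G < ply \<D> F" using F by (simp add: maximal_faces_def)
  \<comment> \<open>\<open>F\<close> and \<open>G\<close> both have points in \<open>N\<close>,
    which lies entirely inside or entirely outside each other disk.\<close>
  have "F \<subseteq> D' \<longleftrightarrow> G \<subseteq> D'" if D': "D' \<in> \<D>" "D' \<noteq> D" for D'
  proof -
    have "F \<subseteq> D' \<longleftrightarrow> x \<in> D'"
      using face_subset_disk[OF Ff D'(1) x(1)] x(1) interior_subset by blast
    also have "\<dots> \<longleftrightarrow> y \<in> D'" using dich[OF D'] x y by blast
    also have "\<dots> \<longleftrightarrow> G \<subseteq> D'"
      using face_subset_disk[OF G(1) D'(1) G(2)] G(2) interior_subset by blast
    finally show ?thesis .
  qed
  then have "{D \<in> \<D>. F \<subseteq> D} \<subseteq> {D \<in> \<D>. G \<subseteq> D}" using nF by blast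
  then have "ply \<D> F \<le> ply \<D> G" unfolding ply_def using fin by (intro card_mono) auto
  then show False using lt by simp
qed

text \<open>By \<open>maximal_face_boundary_point\<close> only a vertex could violate this. As
  vertices are isolated, \<open>F\<close> would then contain a punctured ball around it, yet some
  disk boundary passes through the vertex and has both of its sides there.\<close>

lemma frontier_maximal_face:
  assumes F: "F \<in> maximal_faces \<D>"
  shows "frontier F \<subseteq> (\<Union>D\<in>{D \<in> \<D>. F \<subseteq> D}. frontier D)" (is "_ \<subseteq> ?K")
proof
  fix p assume p: "p \<in> frontier F"
  show "p \<in> ?K"
  proof (rule ccontr)
    assume np: "p \<notin> ?K"
    have Ff: "F \<in> arr_faces \<D>" using F by (simp add: maximal_faces_def)
    note fp = face_props[OF Ff]
    have "closed ?K" using fin by auto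
    moreover have "closed (arr_vertices \<D> - {p})" using finite_arr_vertices by (simp add: finite_imp_closed)
    ultimately have "open (- (?K \<union> (arr_vertices \<D> - {p})))" by blast
    moreover have "p \<in> - (?K \<union> (arr_vertices \<D> - {p}))" using np by blast
    ultimately obtain \<epsilon> where \<epsilon>: "\<epsilon> > 0" "ball p \<epsilon> \<subseteq> - (?K \<union> (arr_vertices \<D> - {p}))"
      using open_contains_ball by metis
    define B where "B = ball p \<epsilon> - {p}"
    have B: "connected B" unfolding B_def by (intro connected_punctured_ball) simp
    have dense: "B \<inter> S \<noteq> {}" if pS: "p \<in> closure S" "p \<notin> S" for S
    proof -
      have "p \<in> ball p \<epsilon> \<inter> closure S" using pS(1) \<epsilon>(1) by simp
      then have "ball p \<epsilon> \<inter> S \<noteq> {}" using open_Int_closure_eq_empty[OF open_ball, of p \<epsilon> S] by blast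
      then show ?thesis using pS(2) by (auto simp: B_def)
    qed
    have "B \<inter> frontier F = {}"
    proof safe
      fix q assume q: "q \<in> B" "q \<in> frontier F"
      then obtain D where D: "D \<in> \<D>" "q \<in> frontier D" using fp(5) by blast
      have "q \<notin> arr_vertices \<D>" using q \<epsilon> by (auto simp: B_def)
      then have "F \<subseteq> D" using maximal_face_boundary_point[OF F q(2) _ D] by blast
      then show "q \<in> {}" using D q \<epsilon> by (auto simp: B_def)
    qed
    moreover have "p \<notin> F" "p \<in> closure F" using p fp(1) by (auto simp: frontier_def interior_open)
    then have "B \<inter> F \<noteq> {}" using dense by blast
    ultimately have "B \<subseteq> F" using connected_Int_frontier[OF B, of F] by blast
    obtain D where D: "D \<in> \<D>" "p \<in> frontier D" using fp(5) p by blast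
    note tp = topological_disk_props[OF disk[OF D(1)]]
    have "B \<inter> frontier D = {}" using \<open>B \<subseteq> F\<close> fp(4) D(1) by blast
    moreover have "B \<inter> interior D \<noteq> {}" using dense[of "interior D"] tp(7,10) D(2) by blast
    ultimately have "B \<subseteq> interior D" using connected_subset_interior[OF B] interior_subset by blast
    moreover have "B \<inter> - D \<noteq> {}" using dense[of "- D"] tp(8,9) D(2) by blast
    ultimately show False using interior_subset by blast
  qed
qed

text \<open>A connected set in the common interior misses the boundaries of all disks containing
  \<open>F\<close>, hence by \<open>frontier_maximal_face\<close> also \<open>frontier F\<close>,
  and so cannot leave \<open>F\<close>.\<close>

lemma maximal_face_component:
  assumes F: "F \<in> maximal_faces \<D>" and "x \<in> F"
    and "connected_component (\<Inter>D\<in>{D \<in> \<D>. x \<in> D}. interior D) x y"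
  shows "y \<in> F"
proof -
  have Ff: "F \<in> arr_faces \<D>" using F by (simp add: maximal_faces_def)
  have S: "{D \<in> \<D>. F \<subseteq> D} = {D \<in> \<D>. x \<in> D}"
    using face_subset_disk[OF Ff _ \<open>x \<in> F\<close>] interior_subset \<open>x \<in> F\<close> by blast
  obtain C where C: "connected C" "C \<subseteq> (\<Inter>D\<in>{D \<in> \<D>. x \<in> D}. interior D)" "x \<in> C" "y \<in> C"
    using assms(3) by (auto simp: connected_component_def)
  have "C \<inter> frontier F = {}"
    using frontier_maximal_face[OF F] C(2) topological_disk_props(10)[OF disk] unfolding S by blast
  then have "C \<subseteq> F" using connected_Int_frontier[OF C(1), of F] C(3) \<open>x \<in> F\<close> by blast
  then show ?thesis using C by blast
qed

text \<open>\<open>F\<close> is not the whole plane, so it has a boundary point, and by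
  \<open>frontier_maximal_face\<close> this lies on the boundary of a disk containing
  \<open>F\<close>.\<close>

lemma maximal_face_in_disk:
  assumes F: "F \<in> maximal_faces \<D>" and "x \<in> F" "\<D> \<noteq> {}"
  shows "\<exists>D\<in>\<D>. x \<in> D"
proof -
  have Ff: "F \<in> arr_faces \<D>" using F by (simp add: maximal_faces_def)
  obtain D where "D \<in> \<D>" using \<open>\<D> \<noteq> {}\<close> by blast
  then have "boundaries \<noteq> {}" using topological_disk_props(6)[OF disk] by blast
  then have "F \<noteq> UNIV" using face_props(4)[OF Ff] by blast
  then have "frontier F \<noteq> {}" using \<open>x \<in> F\<close> frontier_eq_empty[of F] by blast
  then show ?thesis using frontier_maximal_face[OF F] \<open>x \<in> F\<close> by blast
qed

end

section \<open>Encoding and counting maximal faces\<close>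

context disk_arrangement
begin

lemma locally_one_component_pair:
  assumes "A \<in> \<D>" "B \<in> \<D>" "A \<noteq> B"
  shows "locally_one_component (A \<inter> B) (interior A \<inter> interior B)"
  using assms gp by (intro locally_one_component_Int_disks disk) (auto simp: general_position_def)

text \<open>The value at \<open>{A, B}\<close> is \<^term>\<open>{}\<close> exactly if \<^term>\<open>x\<close> is not in both disks; no component
  is empty, so this adds one value per pair.\<close>

definition signature :: "complex \<Rightarrow> complex set set \<Rightarrow> complex set" where
  "signature x = (\<lambda>e\<in>{e. e \<subseteq> \<D> \<and> card e = 2}. connected_component_set (\<Inter>e) x)"

lemma signature_pair:
  assumes "A \<in> \<D>" "B \<in> \<D>" "A \<noteq> B"
  shows "signature x {A, B} = connected_component_set (A \<inter> B) x"
  using assms by (simp add: signature_def)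

text \<open>Equal signatures put \<open>x\<close> and \<open>x'\<close> into the same disks and the
  same pairwise components. \<open>connected_component_dense\<close> passes to interiors,
  \<open>connected_component_INT\<close> to the common interior, and there \<open>x'\<close> cannot
  leave \<open>F\<close>.\<close>

lemma signature_determines_maximal_face:
  assumes F: "F \<in> maximal_faces \<D>" "x \<in> F" and F': "F' \<in> maximal_faces \<D>" "x' \<in> F'"
    and D: "D \<in> \<D>" "x \<in> D" "x' \<in> D" and sig: "signature x = signature x'"
  shows "F = F'"
proof -
  have Ff: "F \<in> arr_faces \<D>" "F' \<in> arr_faces \<D>" using F F' by (auto simp: maximal_faces_def)
  have int: "z \<in> interior A" if "A \<in> \<D>" "z \<in> A" "z \<in> F \<or> z \<in> F'" for A z
    using face_subset_disk Ff that by blast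
  have ccs: "connected_component_set (A \<inter> B) x = connected_component_set (A \<inter> B) x'"
    if "A \<in> \<D>" "B \<in> \<D>" "A \<noteq> B" for A B
    using signature_pair[OF that] sig by metis
  define S where "S = {A \<in> \<D>. x \<in> A}"
  \<comment> \<open>Here the common disk \<open>D\<close> enters: as both points lie in
    \<open>D\<close>, the value at \<open>{D, A}\<close> is empty exactly if the point is outside
    \<open>A\<close>.\<close>
  have "x \<in> A \<longleftrightarrow> x' \<in> A" if "A \<in> \<D>" for A
  proof (cases "A = D")
    case False
    then show ?thesis
      using ccs[OF D(1) that] D connected_component_eq_empty[of "D \<inter> A"] by (metis Int_iff)
  qed (use D in auto)
  then have S': "S = {A \<in> \<D>. x' \<in> A}" by (auto simp: S_def)
  have "connected_component (\<Inter>A\<in>S. interior A) x x'"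
  proof (rule connected_component_INT)
    show "finite S" "S \<noteq> {}" using fin D by (auto simp: S_def)
    show "connected_component (interior A \<inter> interior B) x x'" if AB: "A \<in> S" "B \<in> S" for A B
    proof -
      have AB': "A \<in> \<D>" "B \<in> \<D>" using AB by (auto simp: S_def)
      have x: "x \<in> interior A" "x \<in> interior B" using AB F by (auto simp: S_def intro: int)
      have x': "x' \<in> interior A" "x' \<in> interior B" using AB F' by (auto simp: S' intro: int)
      show ?thesis
      proof (cases "A = B")
        case True
        then show ?thesis
          using topological_disk_props(2)[OF disk[OF AB'(1)]] x x' unfolding connected_component_def by auto
      next
        case False
        interpret locally_one_component "A \<inter> B" "interior A \<inter> interior B"
          by (rule locally_one_component_pair[OF AB' False])
        have "x' \<in> connected_component_set (A \<inter> B) x'"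
          using x' interior_subset by (auto simp: connected_component_refl_eq)
        then have "connected_component (A \<inter> B) x x'" using ccs[OF AB' False] by auto
        then show ?thesis using connected_component_dense x x' by blast
      qed
    qed
    show "open (interior A)" for A :: "complex set" by simp
    show "bounded (interior A)" "connected (- interior A)" if "A \<in> S" for A
      using topological_disk_props(4,5)[OF disk] that by (auto simp: S_def)
  qed
  then have "x' \<in> F" unfolding S_def by (rule maximal_face_component[OF F])
  then have "F \<inter> F' \<noteq> {}" using F' by blast
  then show ?thesis using Ff unfolding arr_faces_def by (metis components_eq)
qed

lemma finite_components_pair:
  assumes "A \<in> \<D>" "B \<in> \<D>" "A \<noteq> B"
  shows "finite (components (A \<inter> B))"
proof -
  interpret locally_one_component "A \<inter> B" "interior A \<inter> interior B"
    by (rule locally_one_component_pair[OF assms])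
  show ?thesis
    using topological_disk_props(1)[OF disk] assms by (intro finite_components compact_Int) auto
qed

lemma card_components_pair_le_overlap_number:
  assumes "A \<in> \<D>" "B \<in> \<D>" "A \<noteq> B"
  shows "card (components (A \<inter> B)) \<le> overlap_number \<D>"
proof -
  have "{card (components (A \<inter> B)) |A B. A \<in> \<D> \<and> B \<in> \<D> \<and> A \<noteq> B}
      \<subseteq> (\<lambda>(A, B). card (components (A \<inter> B))) ` (\<D> \<times> \<D>)" by auto
  then have "finite {card (components (A \<inter> B)) |A B. A \<in> \<D> \<and> B \<in> \<D> \<and> A \<noteq> B}"
    by (rule finite_subset) (use fin in auto)
  then show ?thesis unfolding overlap_number_def using assms by (intro Max_ge) auto
qed

theorem card_maximal_faces_le:
  assumes "\<D> \<noteq> {}"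
  shows "finite (maximal_faces \<D>)"
    and "card (maximal_faces \<D>) \<le> card \<D> * (overlap_number \<D> + 1) ^ (card \<D> choose 2)"
proof -
  define P where "P = {e. e \<subseteq> \<D> \<and> card e = 2}"
  define T where "T = (\<lambda>e :: complex set set. insert {} (components (\<Inter>e)))"
  define pt where "pt = (\<lambda>F :: complex set. SOME x. x \<in> F)"
  have pt: "pt F \<in> F" if "F \<in> maximal_faces \<D>" for F
    using face_props(3)[of F] that unfolding pt_def maximal_faces_def by (auto intro: someI)
  obtain d where d: "d F \<in> \<D> \<and> pt F \<in> d F" if "F \<in> maximal_faces \<D>" for F
    using maximal_face_in_disk[OF _ pt assms] by metis
  \<comment> \<open>One chosen point represents each face; injectivity holds for every choice, since
    \<open>signature_determines_maximal_face\<close> allows arbitrary points of the faces.\<close>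
  define \<Phi> where "\<Phi> = (\<lambda>F. (d F, signature (pt F)))"
  have finP: "finite P" unfolding P_def using fin by simp
  have pair: "finite (T e) \<and> card (T e) \<le> overlap_number \<D> + 1" if "e \<in> P" for e
  proof -
    obtain A B where e: "e = {A, B}" "A \<noteq> B" "A \<in> \<D>" "B \<in> \<D>"
      using \<open>e \<in> P\<close> unfolding P_def by (auto simp: card_2_iff)
    have "finite (components (\<Inter>e))" "card (components (\<Inter>e)) \<le> overlap_number \<D>"
      using finite_components_pair[OF e(3,4,2)] card_components_pair_le_overlap_number[OF e(3,4,2)] e(1)
      by auto
    then show ?thesis unfolding T_def by (auto simp: card_insert_if)
  qed
  have "finite (PiE P T)" using finP pair by (intro finite_PiE) auto
  then have finR: "finite (\<D> \<times> PiE P T)" using fin by simp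
  \<comment> \<open>A connected component set is empty or a component, and \<open>T\<close> contains
    both kinds of value.\<close>
  have "signature x \<in> PiE P T" for x
    unfolding P_def T_def signature_def
    by (rule restrict_PiE_iff[THEN iffD2]) (metis componentsI connected_component_eq_empty insertCI)
  then have sub: "\<Phi> ` maximal_faces \<D> \<subseteq> \<D> \<times> PiE P T" using d by (auto simp: \<Phi>_def)
  have inj: "inj_on \<Phi> (maximal_faces \<D>)"
  proof (rule inj_onI)
    fix F F' assume F: "F \<in> maximal_faces \<D>" "F' \<in> maximal_faces \<D>" "\<Phi> F = \<Phi> F'"
    then have "d F = d F'" "signature (pt F) = signature (pt F')" by (simp_all add: \<Phi>_def)
    then show "F = F'"
      using signature_determines_maximal_face[OF F(1) pt[OF F(1)] F(2) pt[OF F(2)]] d[OF F(1)] d[OF F(2)] by metis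
  qed
  show "finite (maximal_faces \<D>)" using inj sub finR by (meson finite_imageD finite_subset)
  have "card (maximal_faces \<D>) \<le> card (\<D> \<times> PiE P T)"
    by (rule card_inj_on_le[OF inj sub finR])
  also have "\<dots> = card \<D> * (\<Prod>e\<in>P. card (T e))"
    by (simp add: card_cartesian_product card_PiE[OF finP])
  also have "\<dots> \<le> card \<D> * (\<Prod>e\<in>P. overlap_number \<D> + 1)"
    using pair by (intro mult_left_mono prod_mono) auto
  also have "\<dots> = card \<D> * (overlap_number \<D> + 1) ^ (card \<D> choose 2)"
    using n_subsets[OF fin, of 2] by (simp add: P_def)
  finally show "card (maximal_faces \<D>) \<le> card \<D> * (overlap_number \<D> + 1) ^ (card \<D> choose 2)" .
qed

end

theorem theorem2:
  fixes \<D> :: "complex set set" and n \<Delta> :: nat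
  assumes "n > 2"
    and "finite \<D>" and "card \<D> = n"
    and "\<forall>D\<in>\<D>. topological_disk D"
    and "general_position \<D>"
    and "overlap_number \<D> = \<Delta>"
  shows "finite (maximal_faces \<D>) \<and>
         card (maximal_faces \<D>) \<le> n * (\<Delta> + 1) ^ (n * (n - 1) div 2)"
proof -
  interpret disk_arrangement \<D> using assms by unfold_locales auto
  have "\<D> \<noteq> {}" using assms by auto
  from card_maximal_faces_le[OF this] show ?thesis
    using assms by (simp add: choose_two)
qed

end
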